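(* For all integers $m,n\ge 10$, $$\left\lceil \frac{2(m+1)n}{5}\right\rceil \le \gamma_R(P_m\Box C_n).$$
   Context: A Roman dominating function of a graph $G$ is a function $f\colon V(G)\to\{0,1,2\}$ such that every vertex $v$ with $f(v)=0$ is adjacent to at least one vertex $w$ with $f(w)=2$. Its weight is $f(G)=\sum_{u\in V(G)}f(u)$, and the Roman domination number $\gamma_R(G)$ is the minimum weight of a Roman dominating function of $G$. $P_m$ is the path with $m$ vertices and $C_n$ is the cycle with $n$ vertices. The cylinder $P_m\Box C_n$ is their Cartesian product: vertex set $V(P_m)\times V(C_n)$, with $(u_1,v_1)$ and $(u_2,v_2)$ adjacent if and only if either $u_1=u_2$ and $v_1,v_2$ are adjacent in $C_n$, or $u_1,u_2$ are adjacent in $P_m$ and $v_1=v_2$. *)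

theory Defs
  imports Complex_Main "HOL-Library.FuncSet" "Graph_Theory.Pair_Digraph"
begin

text \<open>
  A finite simple graph is a \<open>pair_graph\<close>: an undirected edge is represented by its two
  opposite arcs.
\<close>

definition path_graph :: "nat \<Rightarrow> nat pair_pre_digraph" where
  "path_graph m = \<lparr>pverts = {..<m},
     parcs = {(u, v). u < m \<and> v < m \<and> (v = Suc u \<or> u = Suc v)}\<rparr>"

text \<open>The following is a simple graph, and hence the usual cycle, only for \<open>n \<ge> 3\<close>.\<close>

definition cycle_graph :: "nat \<Rightarrow> nat pair_pre_digraph" where
  "cycle_graph n = \<lparr>pverts = {..<n},
     parcs = {(u, v). u < n \<and> v < n \<and> (v = Suc u mod n \<or> u = Suc v mod n)}\<rparr>"

definition cartesian_product ::
    "'a pair_pre_digraph \<Rightarrow> 'b pair_pre_digraph \<Rightarrow> ('a \<times> 'b) pair_pre_digraph"  (infixr \<open>\<box>\<close> 70) where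
  "G \<box> H = \<lparr>pverts = pverts G \<times> pverts H,
     parcs = {((u1, v1), (u2, v2)).
       (u1 = u2 \<and> u1 \<in> pverts G \<and> (v1, v2) \<in> parcs H) \<or>
       ((u1, u2) \<in> parcs G \<and> v1 = v2 \<and> v1 \<in> pverts H)}\<rparr>"

definition roman_dominating :: "'a pair_pre_digraph \<Rightarrow> ('a \<Rightarrow> nat) \<Rightarrow> bool" where
  "roman_dominating G f \<longleftrightarrow> f \<in> pverts G \<rightarrow> {0, 1, 2} \<and>
     (\<forall>v \<in> pverts G. f v = 0 \<longrightarrow> (\<exists>w \<in> pverts G. (v, w) \<in> parcs G \<and> f w = 2))"

definition weight :: "'a pair_pre_digraph \<Rightarrow> ('a \<Rightarrow> nat) \<Rightarrow> nat" where
  "weight G f = (\<Sum>u \<in> pverts G. f u)"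

definition roman_domination_number :: "'a pair_pre_digraph \<Rightarrow> nat"  (\<open>\<gamma>\<^sub>R\<close>) where
  "\<gamma>\<^sub>R G = (LEAST k. \<exists>f. roman_dominating G f \<and> weight G f = k)"

lemma pair_graph_path_graph: "pair_graph (path_graph m)"
proof -
  have "finite (parcs (path_graph m))"
    by (rule finite_subset[of _ "{..<m} \<times> {..<m}"]) (auto simp: path_graph_def)
  then show ?thesis
    by unfold_locales (auto simp: path_graph_def symmetric_def sym_def)
qed

lemma pair_graph_cycle_graph:
  assumes "n \<ge> 3"
  shows "pair_graph (cycle_graph n)"
proof -
  have "finite (parcs (cycle_graph n))"
    by (rule finite_subset[of _ "{..<n} \<times> {..<n}"]) (auto simp: cycle_graph_def)
  moreover have "Suc u mod n \<noteq> u" "u \<noteq> Suc u mod n" if "u < n" for u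
    using that assms by (cases "Suc u = n"; auto)+
  ultimately show ?thesis
    by unfold_locales (auto simp: cycle_graph_def symmetric_def sym_def)
qed

lemma pair_graph_cartesian_product:
  assumes "pair_graph G" "pair_graph H"
  shows "pair_graph (G \<box> H)"
proof -
  interpret G: pair_graph G by fact
  interpret H: pair_graph H by fact
  have "finite (parcs (G \<box> H))"
    by (rule finite_subset[of _ "(pverts G \<times> pverts H) \<times> (pverts G \<times> pverts H)"])
      (auto simp: cartesian_product_def G.pair_finite_verts H.pair_finite_verts
        dest: G.wellformed' H.wellformed')
  then show ?thesis
    by unfold_locales
      (auto simp: cartesian_product_def G.pair_finite_verts H.pair_finite_verts
        symmetric_def sym_def dest: G.wellformed' H.wellformed' G.arcs_symmetric H.arcs_symmetric
          G.no_loops' H.no_loops')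
qed

lemma roman_domination_number_attained:
  obtains f where "roman_dominating G f" "weight G f = \<gamma>\<^sub>R G"
proof -
  have "roman_dominating G (\<lambda>_. 1)"
    by (auto simp: roman_dominating_def)
  then have "\<exists>k f. roman_dominating G f \<and> weight G f = k"
    by blast
  then have "\<exists>f. roman_dominating G f \<and> weight G f = \<gamma>\<^sub>R G"
    unfolding roman_domination_number_def by (rule LeastI_ex)
  then show thesis
    using that by blast
qed

lemma roman_domination_number_le:
  "roman_dominating G f \<Longrightarrow> \<gamma>\<^sub>R G \<le> weight G f"
  unfolding roman_domination_number_def by (rule Least_le) blast

end

theory Submission
  imports Defs
begin

text \<open>
  Let \<open>D\<close> be the set of vertices of value 2 and \<open>k v\<close> the number of elements of \<open>D\<close> in the closed
  neighbourhood of \<open>v\<close>. A vertex with \<open>k v = 0\<close> has value 1, and \<open>k\<close> sums to \<open>5 * card D\<close> minus the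
  number of elements of \<open>D\<close> in the two border rows. Hence five times the weight is at least \<open>2 * m * n\<close>
  plus twice the latter number plus the total excess, where a vertex has excess 3 if \<open>k v = 0\<close> and
  \<open>2 * (k v - 1)\<close> otherwise. It remains to gain \<open>n\<close> at each border, and the four outermost rows
  suffice for that: in this strip the gain is 1 per column on average, because the gain of a column
  \<open>b\<close> with neighbouring columns \<open>a\<close> and \<open>c\<close> is at least \<open>1 + p a b - p b c\<close> for a suitable
  potential \<open>p\<close>, which telescopes around the cycle.
\<close>

definition excess :: "int \<Rightarrow> int" where
  "excess k = (if k = 0 then 3 else 2 * (k - 1))"

text \<open>
  The values solve the system of difference inequalities in \<open>potential_step\<close>; they were found by a
  shortest path computation on the graph of pairs of adjacent columns, merging states where possible.
\<close>

definition potential :: "bool \<Rightarrow> bool \<Rightarrow> bool \<Rightarrow> bool \<Rightarrow> bool \<Rightarrow> bool \<Rightarrow> bool \<Rightarrow> bool \<Rightarrow> int" where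
  "potential a0 a1 a2 a3 b0 b1 b2 b3 =
    (if a0 then
       if b0 \<or> b1 \<or> b2 then 3
       else if b3 then if a1 \<or> a2 \<or> a3 then 3 else 1
       else if a1 then 0
       else if a2 then if a3 then 0 else 1
       else 3
     else if a1 then 3
     else if b1 then
       if a2 then 3
       else if b0 then if a3 then 3 else 5
       else if b2 then if a3 then 3 else 4
       else if b3 then 3
       else 2
     else if a3 then if b2 then 3 else 4
     else if a2 then
       if b2 \<or> b3 then 3
       else if b0 then 2
       else 4
     else if b0 then 4
     else 1)"

text \<open>\<open>a\<close>, \<open>b\<close>, \<open>c\<close> are consecutive columns of the
  strip, listed from the border inwards, and \<open>b4\<close> is the cell below \<open>b3\<close>,
  which is left free. With all booleans quantified the statement is closed, so evaluating its
  finitely many cases proves it.\<close>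

lemma potential_step:
  "\<forall>a0 a1 a2 a3 b0 b1 b2 b3 c0 c1 c2 c3 b4.
   1 + potential a0 a1 a2 a3 b0 b1 b2 b3 \<le>
   2 * of_bool b0
   + excess (of_bool a0 + of_bool b0 + of_bool c0 + of_bool b1)
   + excess (of_bool a1 + of_bool b1 + of_bool c1 + of_bool b0 + of_bool b2)
   + excess (of_bool a2 + of_bool b2 + of_bool c2 + of_bool b1 + of_bool b3)
   + excess (of_bool a3 + of_bool b3 + of_bool c3 + of_bool b2 + of_bool b4)
   + potential b0 b1 b2 b3 c0 c1 c2 c3"
  by code_simp


text \<open>
  Counts around the cell in row \<open>i\<close> and column \<open>Suc j\<close>, so that no predecessor modulo the length of
  the cycle is needed.
\<close>

definition closed_count :: "(nat \<Rightarrow> nat \<Rightarrow> bool) \<Rightarrow> nat \<Rightarrow> nat \<Rightarrow> int" where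
  "closed_count y i j =
    of_bool (y i j) + of_bool (y i (Suc j)) + of_bool (y i (Suc (Suc j)))
    + (if i = 0 then 0 else of_bool (y (i - 1) (Suc j))) + of_bool (y (Suc i) (Suc j))"

lemma closed_count_nonneg: "0 \<le> closed_count y i j"
  by (simp add: closed_count_def)

text \<open>The linear part can be summed by double counting; the 5 is five times the value 1 of an
  undominated vertex.\<close>

lemma excess_eq: "excess k = 2 * k - 2 + 5 * of_bool (k = 0)"
  by (simp add: excess_def)

lemma excess_nonneg: "0 \<le> k \<Longrightarrow> 0 \<le> excess k"
  by (simp add: excess_def)

lemma sum_Suc_periodic:
  fixes F :: "nat \<Rightarrow> 'a :: ab_group_add"
  assumes "F n = F 0"
  shows "(\<Sum>j<n. F (Suc j)) = (\<Sum>j<n. F j)"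
  using sum_lessThan_telescope[of F n] assms by (simp add: sum_subtractf)

text \<open>Summing \<open>potential_step\<close> once around the cycle cancels the potentials and
  leaves a gain of 1 per column.\<close>

lemma border_excess:
  assumes periodic: "\<And>i j. y i (j + n) = y i j"
  shows "int n \<le> 2 * (\<Sum>j<n. of_bool (y 0 j)) + (\<Sum>i<4. \<Sum>j<n. excess (closed_count y i j))"
proof -
  define p where "p j = potential (y 0 j) (y 1 j) (y 2 j) (y 3 j)
    (y 0 (Suc j)) (y 1 (Suc j)) (y 2 (Suc j)) (y 3 (Suc j))" for j
  have y_n: "y i n = y i 0" "y i (Suc n) = y i (Suc 0)" for i
    using periodic[of i 0] periodic[of i 1] by simp_all
  have step: "1 + p j \<le> 2 * of_bool (y 0 (Suc j)) + (\<Sum>i<4. excess (closed_count y i j)) + p (Suc j)"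
    for j
    using potential_step[rule_format, of "y 0 j" "y 1 j" "y 2 j" "y 3 j"
      "y 0 (Suc j)" "y 1 (Suc j)" "y 2 (Suc j)" "y 3 (Suc j)"
      "y 0 (Suc (Suc j))" "y 1 (Suc (Suc j))" "y 2 (Suc (Suc j))" "y 3 (Suc (Suc j))" "y 4 (Suc j)"]
    by (simp add: p_def closed_count_def eval_nat_numeral algebra_simps)
  have "(\<Sum>j<n. 1 + p j) \<le>
      (\<Sum>j<n. 2 * of_bool (y 0 (Suc j)) + (\<Sum>i<4. excess (closed_count y i j)) + p (Suc j))"
    by (intro sum_mono step)
  moreover have "(\<Sum>j<n. p (Suc j)) = (\<Sum>j<n. p j)"
    by (rule sum_Suc_periodic) (simp add: p_def y_n)
  moreover have "(\<Sum>j<n. of_bool (y 0 (Suc j))) = (\<Sum>j<n. of_bool (y 0 j) :: int)"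
    by (rule sum_Suc_periodic) (simp add: y_n)
  moreover have "(\<Sum>j<n. \<Sum>i<4. excess (closed_count y i j)) = (\<Sum>i<4. \<Sum>j<n. excess (closed_count y i j))"
    by (rule sum.swap)
  ultimately show ?thesis
    by (simp add: sum.distrib flip: sum_distrib_left)
qed

text \<open>Double counting: a true cell lies in five closed neighbourhoods, but in a border row one
  of them is centred outside the grid. Since row \<open>m\<close> is empty, it adds nothing to the
  counts in row \<open>m - 1\<close>.\<close>

lemma sum_closed_count:
  assumes periodic: "\<And>i j. y i (j + n) = y i j"
    and outside: "\<And>j. \<not> y m j" and "m > 0"
  shows "(\<Sum>i<m. \<Sum>j<n. closed_count y i j) =
    5 * (\<Sum>i<m. \<Sum>j<n. of_bool (y i j)) - (\<Sum>j<n. of_bool (y 0 j)) - (\<Sum>j<n. of_bool (y (m - 1) j))"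
proof -
  define r where "r i = (\<Sum>j<n. of_bool (y i j) :: int)" for i
  have y_n: "y i n = y i 0" "y i (Suc n) = y i (Suc 0)" for i
    using periodic[of i 0] periodic[of i 1] by simp_all
  have r_Suc: "(\<Sum>j<n. of_bool (y i (Suc j))) = r i" for i
    unfolding r_def by (rule sum_Suc_periodic) (simp add: y_n)
  have r_Suc2: "(\<Sum>j<n. of_bool (y i (Suc (Suc j)))) = r i" for i
    unfolding r_Suc[symmetric] by (rule sum_Suc_periodic) (simp add: y_n)
  have row: "(\<Sum>j<n. closed_count y i j) = 3 * r i + (if i = 0 then 0 else r (i - 1)) + r (Suc i)" for i
    unfolding closed_count_def
    by (cases "i = 0") (simp_all add: sum.distrib r_Suc r_Suc2 flip: r_def)
  obtain k where k: "m = Suc k"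
    using \<open>m > 0\<close> by (cases m) auto
  have "r m = 0"
    using outside by (simp add: r_def)
  moreover have "(\<Sum>i<Suc k. r i) = r 0 + (\<Sum>i<k. r (Suc i))"
    by (rule sum.lessThan_Suc_shift)
  moreover have "(\<Sum>i<Suc k. if i = 0 then 0 else r (i - 1)) = (\<Sum>i<k. r i)"
    by (simp add: sum.lessThan_Suc_shift del: sum.lessThan_Suc)
  ultimately show ?thesis
    unfolding row r_def[symmetric] sum.distrib k by (simp flip: sum_distrib_left)
qed

lemma roman_weight_lower_bound:
  assumes f: "roman_dominating (path_graph m \<box> cycle_graph n) f" and "m \<ge> 8" "n > 0"
  shows "2 * (int m + 1) * int n \<le> 5 * int (weight (path_graph m \<box> cycle_graph n) f)"
proof -
  \<comment> \<open>The set of vertices of value 2, unrolled periodically along the cycle and empty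
    from row \<open>m\<close> on.\<close>
  define x where "x i j \<longleftrightarrow> i < m \<and> f (i, j mod n) = 2" for i j
  define E where "E i = (\<Sum>j<n. excess (closed_count x i j))" for i
  define r where "r i = (\<Sum>j<n. of_bool (x i j) :: int)" for i
  have periodic: "x i (j + n) = x i j" for i j
    by (simp add: x_def)
  have r_Suc: "(\<Sum>j<n. of_bool (x i (Suc j))) = r i" for i
    unfolding r_def by (rule sum_Suc_periodic) (simp add: x_def)
  have range: "f (i, j) \<in> {0, 1, 2}" if "i < m" "j < n" for i j
  proof -
    have "f \<in> pverts (path_graph m \<box> cycle_graph n) \<rightarrow> {0, 1, 2}"
      using f by (simp add: roman_dominating_def)
    moreover have "(i, j) \<in> pverts (path_graph m \<box> cycle_graph n)"
      using that by (simp add: cartesian_product_def path_graph_def cycle_graph_def)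
    ultimately show ?thesis
      by (rule funcset_mem)
  qed
  have uncovered: "f (i, Suc j mod n) = 1" if "i < m" and zero: "closed_count x i j = 0" for i j
  proof (rule ccontr)
    have none: "\<not> x i j" "\<not> x i (Suc j)" "\<not> x i (Suc (Suc j))" "\<not> x (Suc i) (Suc j)"
      "i \<noteq> 0 \<Longrightarrow> \<not> x (i - 1) (Suc j)"
      using zero unfolding closed_count_def by (auto simp: of_bool_def split: if_splits)
    let ?v = "Suc j mod n"
    assume "f (i, ?v) \<noteq> 1"
    moreover have "f (i, ?v) \<noteq> 2"
      using none(2) \<open>i < m\<close> by (simp add: x_def)
    ultimately have "f (i, ?v) = 0"
      using range[of i ?v] \<open>i < m\<close> \<open>n > 0\<close> by auto
    moreover have "(i, ?v) \<in> pverts (path_graph m \<box> cycle_graph n)"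
      using \<open>i < m\<close> \<open>n > 0\<close> by (simp add: cartesian_product_def path_graph_def cycle_graph_def)
    ultimately obtain w where "((i, ?v), w) \<in> parcs (path_graph m \<box> cycle_graph n)" "f w = 2"
      using f unfolding roman_dominating_def by blast
    then obtain i' v' where w: "((i, ?v), (i', v')) \<in> parcs (path_graph m \<box> cycle_graph n)"
        and two: "f (i', v') = 2"
      by (cases w) blast
    from w consider "i' = i" "v' = Suc ?v mod n" | "i' = i" "v' < n" "?v = Suc v' mod n"
      | "i' = Suc i" "v' = ?v" "i' < m" | "i = Suc i'" "v' = ?v"
      by (auto simp: cartesian_product_def path_graph_def cycle_graph_def)
    then show False
    proof cases
      case 1
      then show False using none(3) two \<open>i < m\<close> by (simp add: x_def mod_Suc_eq)
    next
      case 2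
      \<comment> \<open>Taking the successor modulo \<open>n\<close> is injective on the
        columns.\<close>
      then have "v' = j mod n"
        by (auto simp: mod_Suc split: if_splits)
      then show False using none(1) two 2 \<open>i < m\<close> by (simp add: x_def)
    next
      case 3
      then show False using none(4) two by (simp add: x_def)
    next
      case 4
      then show False using none(5) two \<open>i < m\<close> by (simp add: x_def)
    qed
  qed
  \<comment> \<open>The two indicators exclude each other, because the closed neighbourhood contains
    the vertex itself.\<close>
  have vertex: "10 * of_bool (x i (Suc j)) + 5 * of_bool (closed_count x i j = 0)
      \<le> 5 * int (f (i, Suc j mod n))" if "i < m" for i j
  proof (cases "closed_count x i j = 0")
    case True
    then have "\<not> x i (Suc j)"
      using closed_count_def[of x i j] by (auto simp: of_bool_def split: if_splits)
    then show ?thesis using uncovered[OF that True] True by simp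
  next
    case False
    then show ?thesis by (auto simp: x_def)
  qed
  have "weight (path_graph m \<box> cycle_graph n) f = (\<Sum>i<m. \<Sum>j<n. f (i, j))"
    by (simp add: weight_def cartesian_product_def path_graph_def cycle_graph_def sum.cartesian_product)
  also have "\<dots> = (\<Sum>i<m. \<Sum>j<n. f (i, j mod n))"
    by simp
  finally have "int (weight (path_graph m \<box> cycle_graph n) f) = (\<Sum>i<m. \<Sum>j<n. int (f (i, j mod n)))"
    by simp
  \<comment> \<open>The shift by one column matches the centre \<open>Suc j\<close> of
    \<open>closed_count x i j\<close>.\<close>
  also have "\<dots> = (\<Sum>i<m. \<Sum>j<n. int (f (i, Suc j mod n)))"
    by (intro sum.cong refl sum_Suc_periodic[symmetric]) simp
  finally have weight: "5 * int (weight (path_graph m \<box> cycle_graph n) f)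
      = (\<Sum>i<m. \<Sum>j<n. 5 * int (f (i, Suc j mod n)))"
    by (simp add: sum_distrib_left)
  have "(\<Sum>i<m. \<Sum>j<n. 10 * of_bool (x i (Suc j)) + 5 * of_bool (closed_count x i j = 0))
      \<le> 5 * int (weight (path_graph m \<box> cycle_graph n) f)"
    unfolding weight by (intro sum_mono vertex) auto
  moreover have "(\<Sum>i<m. \<Sum>j<n. 10 * of_bool (x i (Suc j)) + 5 * of_bool (closed_count x i j = 0))
      = 10 * (\<Sum>i<m. r i) + (\<Sum>i<m. \<Sum>j<n. 5 * of_bool (closed_count x i j = 0) :: int)"
    by (simp add: sum.distrib r_Suc flip: sum_distrib_left)
  moreover have "(\<Sum>i<m. E i) = 2 * (\<Sum>i<m. \<Sum>j<n. closed_count x i j) - 2 * int m * int n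
      + (\<Sum>i<m. \<Sum>j<n. 5 * of_bool (closed_count x i j = 0))"
    by (simp add: E_def excess_eq sum.distrib sum_subtractf flip: sum_distrib_left)
  moreover have "(\<Sum>i<m. \<Sum>j<n. closed_count x i j) = 5 * (\<Sum>i<m. r i) - r 0 - r (m - 1)"
    unfolding r_def using \<open>m \<ge> 8\<close> by (intro sum_closed_count periodic) (auto simp: x_def)
  moreover have "int n \<le> 2 * r 0 + (\<Sum>i<4. E i)"
    unfolding r_def E_def by (rule border_excess) (rule periodic)
  moreover have "int n \<le> 2 * r (m - 1) + (\<Sum>i<4. E (m - 1 - i))"
  proof -
    \<comment> \<open>Reflecting the rows moves the last border to row 0; the row missing there
      corresponds to the empty row \<open>m\<close> of \<open>x\<close>.\<close>
    define y where "y i j \<longleftrightarrow> i < m \<and> x (m - 1 - i) j" for i j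
    have "closed_count y i j = closed_count x (m - 1 - i) j" if "i < 4" for i j
      using that \<open>m \<ge> 8\<close> by (cases i) (auto simp: closed_count_def y_def x_def Suc_diff_Suc)
    moreover have "y i (j + n) = y i j" for i j
      by (simp add: y_def periodic)
    moreover have "y 0 j = x (m - 1) j" for j
      using \<open>m \<ge> 8\<close> by (simp add: y_def)
    ultimately show ?thesis
      using border_excess[of y n] by (simp add: r_def E_def)
  qed
  \<comment> \<open>The two strips are disjoint as \<open>m \<ge> 8\<close>, and the rows between
    them have nonnegative excess.\<close>
  moreover have "(\<Sum>i<4. E i) + (\<Sum>i<4. E (m - 1 - i)) \<le> (\<Sum>i<m. E i)"
  proof -
    have "(\<Sum>i<4. E (m - 1 - i)) = (\<Sum>i\<in>{m - 4..<m}. E i)"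
      using \<open>m \<ge> 8\<close>
      by (intro sum.reindex_bij_witness[of _ "\<lambda>i. m - 1 - i" "\<lambda>i. m - 1 - i"]) auto
    then have "(\<Sum>i<4. E i) + (\<Sum>i<4. E (m - 1 - i)) = (\<Sum>i\<in>{..<4} \<union> {m - 4..<m}. E i)"
      using \<open>m \<ge> 8\<close> by (subst sum.union_disjoint) auto
    also have "\<dots> \<le> (\<Sum>i<m. E i)"
      using \<open>m \<ge> 8\<close>
      by (intro sum_mono2) (auto simp: E_def intro!: sum_nonneg excess_nonneg closed_count_nonneg)
    finally show ?thesis .
  qed
  \<comment> \<open>Five times the weight is at least the sum of \<open>E\<close> plus
    \<open>2 * r 0 + 2 * r (m - 1) + 2 * m * n\<close>, and each border contributes
    \<open>n\<close>.\<close>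
  ultimately show ?thesis
    by (simp add: algebra_simps)
qed

theorem theorem11:
  fixes m n :: nat
  assumes "m \<ge> 10" and "n \<ge> 10"
  shows "\<lceil>2 * (real m + 1) * real n / 5\<rceil> \<le> int (\<gamma>\<^sub>R (path_graph m \<box> cycle_graph n))"
proof -
  obtain f where "roman_dominating (path_graph m \<box> cycle_graph n) f"
    and weight: "weight (path_graph m \<box> cycle_graph n) f = \<gamma>\<^sub>R (path_graph m \<box> cycle_graph n)"
    by (rule roman_domination_number_attained)
  then have "2 * (int m + 1) * int n \<le> 5 * int (\<gamma>\<^sub>R (path_graph m \<box> cycle_graph n))"
    using roman_weight_lower_bound[of m n f] assms by simp
  then have "real_of_int (2 * (int m + 1) * int n) \<le> real_of_int (5 * int (\<gamma>\<^sub>R (path_graph m \<box> cycle_graph n)))"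
    by (simp only: of_int_le_iff)
  then show ?thesis
    by (simp add: ceiling_le_iff)
qed

end
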